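(* Let $(X_1,s^1)$ and $(X_2,s^2)$ be quandles. The quandle Euler characteristic of their direct product satisfies $$\chi^{\mathrm{Qdle}}(X_1\times X_2)=\chi^{\mathrm{Qdle}}(X_1)\cdot\chi^{\mathrm{Qdle}}(X_2).$$
   Context: A quandle is a pair $(X,s)$ of a non-empty set $X$ and a map $s : X \to \mathrm{Map}(X,X)$, $x \mapsto s_x$ (where $\mathrm{Map}(X,X)$ is the set of all maps $X\to X$) such that: (1) $s_x(x)=x$ for all $x\in X$; (2) each $s_x$ is a bijection; (3) $s_x\circ s_y = s_{s_x(y)}\circ s_x$ for all $x,y\in X$. The displacement group $\mathrm{Dis}(X)$ is the group of bijections of $X$ generated under composition by $\{s_x\circ s_y^{-1} \mid x,y\in X\}$. For $g\in \mathrm{Dis}(X)$, $\mathrm{Fix}(g,X)=\{x\in X\mid g(x)=x\}$. The quandle Euler characteristic is $\chi^{\mathrm{Qdle}}(X)=\inf\{\#\mathrm{Fix}(g,X)\mid g\in \mathrm{Dis}(X)\}$, where $\#$ denotes cardinality (possibly infinite; products are products of cardinals, so $0\cdot\infty=0$). The direct product of quandles $(X_1,s^1)$ and $(X_2,s^2)$ is the set $X_1\times X_2$ with the quandle structure $s_{(x_1,x_2)}(y_1,y_2)=(s^1_{x_1}(y_1),s^2_{x_2}(y_2))$. *)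

theory Defs
  imports "HOL-Algebra.Bij" "HOL-Algebra.Generated_Groups"
begin

unbundle cardinal_syntax

text \<open>The map \<open>s x\<close> matters only on the carrier \<open>X\<close>; its values elsewhere are irrelevant.\<close>

locale quandle =
  fixes X :: "'a set" and s :: "'a \<Rightarrow> 'a \<Rightarrow> 'a"
  assumes nonempty: "X \<noteq> {}"
    and idem: "\<And>x. x \<in> X \<Longrightarrow> s x x = x"
    and bij: "\<And>x. x \<in> X \<Longrightarrow> bij_betw (s x) X X"
    and distrib: "\<And>x y z. \<lbrakk>x \<in> X; y \<in> X; z \<in> X\<rbrakk> \<Longrightarrow> s x (s y z) = s (s x y) (s x z)"

text \<open>Bijections of \<open>X\<close> are represented by their extensional versions, as in \<^const>\<open>BijGroup\<close>;
  this is why the point symmetries are restricted to \<open>X\<close>.\<close>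

definition Dis :: "'a set \<Rightarrow> ('a \<Rightarrow> 'a \<Rightarrow> 'a) \<Rightarrow> ('a \<Rightarrow> 'a) set" where
  "Dis X s = generate (BijGroup X)
     {restrict (s x) X \<otimes>\<^bsub>BijGroup X\<^esub> inv\<^bsub>BijGroup X\<^esub> (restrict (s y) X) | x y. x \<in> X \<and> y \<in> X}"

definition Fix :: "('a \<Rightarrow> 'a) \<Rightarrow> 'a set \<Rightarrow> 'a set" where
  "Fix g X = {x \<in> X. g x = x}"

text \<open>Cardinals are cardinal orders in the sense of \<^const>\<open>Card_order\<close>, compared by \<open>\<le>o\<close> and
  identified up to \<open>=o\<close>. The infimum is the greatest lower bound; it is determined only up to
  \<open>=o\<close>, whence the choice of a representative. Competing lower bounds need only range over
  \<open>'a rel\<close>, since a cardinal below some member of a non-empty \<open>R\<close> has a representative there.\<close>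

definition is_card_Inf :: "'a rel set \<Rightarrow> 'a rel \<Rightarrow> bool" where
  "is_card_Inf R r \<longleftrightarrow> Card_order r \<and> (\<forall>r'\<in>R. r \<le>o r') \<and>
     (\<forall>q :: 'a rel. Card_order q \<and> (\<forall>r'\<in>R. q \<le>o r') \<longrightarrow> q \<le>o r)"

definition card_Inf :: "'a rel set \<Rightarrow> 'a rel" where
  "card_Inf R = (SOME r. is_card_Inf R r)"

lemma is_card_Inf_unique: "is_card_Inf R r \<Longrightarrow> is_card_Inf R q \<Longrightarrow> r =o q"
  unfolding is_card_Inf_def ordIso_iff_ordLeq by blast

lemma is_card_Inf_card_Inf:
  assumes "R \<noteq> {}" and "\<And>r. r \<in> R \<Longrightarrow> Card_order r"
  shows "is_card_Inf R (card_Inf R)"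
proof -
  obtain r where "r \<in> R" "\<forall>r'\<in>R. r \<le>o r'"
    using exists_minim_Card_order[of R] assms by blast
  then have "is_card_Inf R r"
    using assms(2) unfolding is_card_Inf_def by blast
  then show ?thesis
    unfolding card_Inf_def by (rule someI)
qed

definition qdle_euler_char :: "'a set \<Rightarrow> ('a \<Rightarrow> 'a \<Rightarrow> 'a) \<Rightarrow> 'a rel" where
  "qdle_euler_char X s = card_Inf {|Fix g X| | g. g \<in> Dis X s}"

lemma is_card_Inf_qdle_euler_char:
  "is_card_Inf {|Fix g X| | g. g \<in> Dis X s} (qdle_euler_char X s)"
  unfolding qdle_euler_char_def
proof (rule is_card_Inf_card_Inf)
  have "\<one>\<^bsub>BijGroup X\<^esub> \<in> Dis X s"
    unfolding Dis_def by (rule generate.one)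
  then show "{|Fix g X| | g. g \<in> Dis X s} \<noteq> {}" by blast
qed (auto simp: card_of_Card_order)

definition quandle_prod ::
  "('a \<Rightarrow> 'a \<Rightarrow> 'a) \<Rightarrow> ('b \<Rightarrow> 'b \<Rightarrow> 'b) \<Rightarrow> 'a \<times> 'b \<Rightarrow> 'a \<times> 'b \<Rightarrow> 'a \<times> 'b" where
  "quandle_prod s1 s2 = (\<lambda>(x1, x2) (y1, y2). (s1 x1 y1, s2 x2 y2))"

lemma quandle_quandle_prod:
  assumes "quandle X1 s1" and "quandle X2 s2"
  shows "quandle (X1 \<times> X2) (quandle_prod s1 s2)"
proof -
  interpret A: quandle X1 s1 by fact
  interpret B: quandle X2 s2 by fact
  show ?thesis
  proof
    show "X1 \<times> X2 \<noteq> {}" using A.nonempty B.nonempty by blast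
  next
    fix x assume "x \<in> X1 \<times> X2"
    then obtain a b where x: "x = (a, b)" "a \<in> X1" "b \<in> X2" by blast
    show "quandle_prod s1 s2 x x = x"
      using x A.idem B.idem by (simp add: quandle_prod_def)
    have "quandle_prod s1 s2 x = map_prod (s1 a) (s2 b)"
      using x by (auto simp: quandle_prod_def fun_eq_iff)
    then show "bij_betw (quandle_prod s1 s2 x) (X1 \<times> X2) (X1 \<times> X2)"
      using bij_betw_map_prod[OF A.bij[OF x(2)] B.bij[OF x(3)]] by (simp add: map_prod_def)
  next
    fix x y z assume "x \<in> X1 \<times> X2" "y \<in> X1 \<times> X2" "z \<in> X1 \<times> X2"
    then show "quandle_prod s1 s2 x (quandle_prod s1 s2 y z) =
        quandle_prod s1 s2 (quandle_prod s1 s2 x y) (quandle_prod s1 s2 x z)"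
      by (clarsimp simp: quandle_prod_def) (metis A.distrib B.distrib)
  qed
qed

end

theory Submission
  imports Defs
begin

text \<open>
  Two facts carry the proof. First, the displacement group of a product is the full product of the
  displacement groups, acting componentwise. Every generator of
  \<open>Dis (X1 \<times> X2)\<close> is a pair of generators, and every pair of generators occurs. Such pairs generate
  the whole product of the two groups because a generating pair may have a trivial component: the
  displacement \<open>s x \<circ> (s x)\<inverse>\<close> is the identity, so each factor can be moved while the other stays
  put (\<open>generate_DirProd\<close>, \<open>Dis_quandle_prod\<close>). Second, a pair \<open>(g, h)\<close> acting componentwise
  fixes exactly the points of \<open>Fix g X1 \<times> Fix h X2\<close>.

  Hence the cardinals over which the infimum for the product runs are the products
  \<open>|Fix g X1| *c |Fix h X2|\<close> with \<open>g\<close> and \<open>h\<close> independent of each other. As cardinals are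
  well-ordered, each of the three infima is attained, and the claim follows from monotonicity of
  cardinal multiplication.
\<close>

section \<open>Generators of a direct product of groups\<close>

text \<open>The hypothesis that both generating sets contain the identity puts
  \<open>S \<times> {\<one>}\<close> and \<open>{\<one>} \<times> T\<close> inside \<open>S \<times> T\<close>; without it the equation can
  fail: \<open>{a} \<times> {b}\<close> always generates a cyclic group, which the product of the groups
  generated by \<open>a\<close> and \<open>b\<close> need not be.\<close>

lemma generate_DirProd:
  assumes G: "group G" and H: "group H"
    and S: "S \<subseteq> carrier G" "\<one>\<^bsub>G\<^esub> \<in> S" and T: "T \<subseteq> carrier H" "\<one>\<^bsub>H\<^esub> \<in> T"
  shows "generate (G \<times>\<times> H) (S \<times> T) = generate G S \<times> generate H T"
proof
  interpret G: group G by fact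
  interpret H: group H by fact
  interpret P: group "G \<times>\<times> H" by (rule DirProd_group[OF G H])
  have "subgroup (generate G S \<times> generate H T) (G \<times>\<times> H)"
    by (intro DirProd_subgroups G H G.generate_is_subgroup H.generate_is_subgroup S T)
  moreover have "S \<times> T \<subseteq> generate G S \<times> generate H T"
    by (auto intro: generate.incl)
  ultimately show "generate (G \<times>\<times> H) (S \<times> T) \<subseteq> generate G S \<times> generate H T"
    by (rule P.generate_subgroup_incl[rotated])
  have left: "(a, \<one>\<^bsub>H\<^esub>) \<in> generate (G \<times>\<times> H) (S \<times> T)" if "a \<in> generate G S" for a
    using that
  proof (induction rule: generate.induct)
    case one
    show ?case using generate.one[of "G \<times>\<times> H"] by (simp add: one_DirProd)
  next
    case (incl a)
    then show ?case using T by (auto intro: generate.incl)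
  next
    case (inv a)
    then have "inv\<^bsub>G \<times>\<times> H\<^esub> (a, \<one>\<^bsub>H\<^esub>) \<in> generate (G \<times>\<times> H) (S \<times> T)"
      using T by (auto intro: generate.inv)
    then show ?case using inv S by (simp add: inv_DirProd[OF G H] subset_iff)
  next
    case (eng a b)
    from generate.eng[OF eng.IH] show ?case by simp
  qed
  have right: "(\<one>\<^bsub>G\<^esub>, b) \<in> generate (G \<times>\<times> H) (S \<times> T)" if "b \<in> generate H T" for b
    using that
  proof (induction rule: generate.induct)
    case one
    show ?case using generate.one[of "G \<times>\<times> H"] by (simp add: one_DirProd)
  next
    case (incl b)
    then show ?case using S by (auto intro: generate.incl)
  next
    case (inv b)
    then have "inv\<^bsub>G \<times>\<times> H\<^esub> (\<one>\<^bsub>G\<^esub>, b) \<in> generate (G \<times>\<times> H) (S \<times> T)"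
      using S by (auto intro: generate.inv)
    then show ?case using inv T by (simp add: inv_DirProd[OF G H] subset_iff)
  next
    case (eng a b)
    from generate.eng[OF eng.IH] show ?case by simp
  qed
  show "generate G S \<times> generate H T \<subseteq> generate (G \<times>\<times> H) (S \<times> T)"
  proof clarify
    fix a b assume ab: "a \<in> generate G S" "b \<in> generate H T"
    then have "a \<in> carrier G" "b \<in> carrier H"
      using G.generate_in_carrier H.generate_in_carrier S T by auto
    then show "(a, b) \<in> generate (G \<times>\<times> H) (S \<times> T)"
      using generate.eng[OF left[OF ab(1)] right[OF ab(2)]] by simp
  qed
qed

section \<open>The displacement group of a product\<close>

text \<open>The restriction makes the result extensional, as elements of \<^const>\<open>BijGroup\<close> must be.\<close>

definition prod_act :: "'a set \<Rightarrow> 'b set \<Rightarrow> ('a \<Rightarrow> 'a) \<times> ('b \<Rightarrow> 'b) \<Rightarrow> 'a \<times> 'b \<Rightarrow> 'a \<times> 'b" where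
  "prod_act X Y = (\<lambda>(g, h). restrict (map_prod g h) (X \<times> Y))"

lemma prod_act_in_Bij:
  assumes "g \<in> Bij X" "h \<in> Bij Y"
  shows "prod_act X Y (g, h) \<in> Bij (X \<times> Y)"
proof -
  have "bij_betw (map_prod g h) (X \<times> Y) (X \<times> Y)"
    using assms bij_betw_map_prod by (auto simp: Bij_def)
  then show ?thesis by (simp add: prod_act_def Bij_def bij_betw_restrict_eq)
qed

lemma group_hom_prod_act:
  "group_hom (BijGroup X \<times>\<times> BijGroup Y) (BijGroup (X \<times> Y)) (prod_act X Y)"
proof (intro group_hom.intro group_hom_axioms.intro homI DirProd_group group_BijGroup)
  fix p assume "p \<in> carrier (BijGroup X \<times>\<times> BijGroup Y)"
  then show "prod_act X Y p \<in> carrier (BijGroup (X \<times> Y))"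
    by (auto simp: BijGroup_def intro: prod_act_in_Bij)
next
  fix p q assume "p \<in> carrier (BijGroup X \<times>\<times> BijGroup Y)" "q \<in> carrier (BijGroup X \<times>\<times> BijGroup Y)"
  then obtain g h g' h' where pq: "p = (g, h)" "q = (g', h')"
    and Bij: "g \<in> Bij X" "h \<in> Bij Y" "g' \<in> Bij X" "h' \<in> Bij Y"
    by (auto simp: BijGroup_def)
  have "g' x \<in> X" if "x \<in> X" for x using Bij that Bij_imp_funcset by blast
  moreover have "h' y \<in> Y" if "y \<in> Y" for y using Bij that Bij_imp_funcset by blast
  ultimately show "prod_act X Y (p \<otimes>\<^bsub>BijGroup X \<times>\<times> BijGroup Y\<^esub> q)
      = prod_act X Y p \<otimes>\<^bsub>BijGroup (X \<times> Y)\<^esub> prod_act X Y q"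
    using Bij prod_act_in_Bij[of g X h Y] prod_act_in_Bij[of g' X h' Y]
    by (auto simp: pq BijGroup_def prod_act_def compose_def fun_eq_iff)
qed

definition displacements :: "'a set \<Rightarrow> ('a \<Rightarrow> 'a \<Rightarrow> 'a) \<Rightarrow> ('a \<Rightarrow> 'a) set" where
  "displacements X s =
     {restrict (s x) X \<otimes>\<^bsub>BijGroup X\<^esub> inv\<^bsub>BijGroup X\<^esub> (restrict (s y) X) | x y. x \<in> X \<and> y \<in> X}"

lemma Dis_eq_generate: "Dis X s = generate (BijGroup X) (displacements X s)"
  by (simp add: Dis_def displacements_def)

context quandle
begin

lemma symmetry_in_BijGroup: "x \<in> X \<Longrightarrow> restrict (s x) X \<in> carrier (BijGroup X)"
  using bij by (simp add: BijGroup_def Bij_def bij_betw_restrict_eq)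

lemma displacements_in_BijGroup: "displacements X s \<subseteq> carrier (BijGroup X)"
proof -
  interpret group "BijGroup X" by (rule group_BijGroup)
  show ?thesis using symmetry_in_BijGroup by (auto simp: displacements_def)
qed

text \<open>The trivial displacement comes from a coinciding pair of points, so it needs \<open>X\<close> to be
  non-empty.\<close>

lemma one_in_displacements: "\<one>\<^bsub>BijGroup X\<^esub> \<in> displacements X s"
proof -
  interpret group "BijGroup X" by (rule group_BijGroup)
  obtain x where x: "x \<in> X" using nonempty by blast
  then have "\<one>\<^bsub>BijGroup X\<^esub> = restrict (s x) X \<otimes>\<^bsub>BijGroup X\<^esub> inv\<^bsub>BijGroup X\<^esub> (restrict (s x) X)"
    using symmetry_in_BijGroup by simp
  then show ?thesis using x unfolding displacements_def by blast
qed

end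

lemma symmetry_quandle_prod:
  "restrict (quandle_prod s1 s2 (x1, x2)) (X1 \<times> X2)
     = prod_act X1 X2 (restrict (s1 x1) X1, restrict (s2 x2) X2)"
  by (auto simp: quandle_prod_def prod_act_def fun_eq_iff)

text \<open>The four points of a pair of displacements are free, so all pairs occur; that they are
  displacements is the homomorphism property of \<open>prod_act\<close>.\<close>

lemma displacements_quandle_prod:
  assumes "quandle X1 s1" "quandle X2 s2"
  shows "displacements (X1 \<times> X2) (quandle_prod s1 s2)
    = prod_act X1 X2 ` (displacements X1 s1 \<times> displacements X2 s2)"
proof -
  interpret A: quandle X1 s1 by fact
  interpret B: quandle X2 s2 by fact
  interpret h: group_hom "BijGroup X1 \<times>\<times> BijGroup X2" "BijGroup (X1 \<times> X2)" "prod_act X1 X2"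
    by (rule group_hom_prod_act)
  let ?s = "\<lambda>x. restrict (s1 x) X1" and ?t = "\<lambda>x. restrict (s2 x) X2"
  let ?u = "\<lambda>x. restrict (quandle_prod s1 s2 x) (X1 \<times> X2)"
  have gen: "?u (x1, x2) \<otimes>\<^bsub>BijGroup (X1 \<times> X2)\<^esub> inv\<^bsub>BijGroup (X1 \<times> X2)\<^esub> ?u (y1, y2)
      = prod_act X1 X2 (?s x1 \<otimes>\<^bsub>BijGroup X1\<^esub> inv\<^bsub>BijGroup X1\<^esub> ?s y1,
                        ?t x2 \<otimes>\<^bsub>BijGroup X2\<^esub> inv\<^bsub>BijGroup X2\<^esub> ?t y2)"
    if x: "x1 \<in> X1" "x2 \<in> X2" "y1 \<in> X1" "y2 \<in> X2" for x1 x2 y1 y2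
  proof -
    have c: "?s x1 \<in> carrier (BijGroup X1)" "?s y1 \<in> carrier (BijGroup X1)"
      "?t x2 \<in> carrier (BijGroup X2)" "?t y2 \<in> carrier (BijGroup X2)"
      using x A.symmetry_in_BijGroup B.symmetry_in_BijGroup by auto
    let ?p = "(?s x1, ?t x2)" and ?q = "(?s y1, ?t y2)"
    have pq: "?p \<in> carrier (BijGroup X1 \<times>\<times> BijGroup X2)" "?q \<in> carrier (BijGroup X1 \<times>\<times> BijGroup X2)"
      using c by auto
    have "?u (x1, x2) \<otimes>\<^bsub>BijGroup (X1 \<times> X2)\<^esub> inv\<^bsub>BijGroup (X1 \<times> X2)\<^esub> ?u (y1, y2)
        = prod_act X1 X2 (?p \<otimes>\<^bsub>BijGroup X1 \<times>\<times> BijGroup X2\<^esub> inv\<^bsub>BijGroup X1 \<times>\<times> BijGroup X2\<^esub> ?q)"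
      unfolding symmetry_quandle_prod
      using pq by (simp only: h.hom_mult h.hom_inv h.G.inv_closed)
    then show ?thesis
      using c by (simp add: inv_DirProd group_BijGroup)
  qed
  show ?thesis
  proof (intro equalityI subsetI)
    fix f assume "f \<in> displacements (X1 \<times> X2) (quandle_prod s1 s2)"
    then obtain x1 x2 y1 y2 where "x1 \<in> X1" "x2 \<in> X2" "y1 \<in> X1" "y2 \<in> X2"
      and "f = ?u (x1, x2) \<otimes>\<^bsub>BijGroup (X1 \<times> X2)\<^esub> inv\<^bsub>BijGroup (X1 \<times> X2)\<^esub> ?u (y1, y2)"
      unfolding displacements_def by blast
    then show "f \<in> prod_act X1 X2 ` (displacements X1 s1 \<times> displacements X2 s2)"
      using gen unfolding displacements_def by blast
  next
    fix f assume "f \<in> prod_act X1 X2 ` (displacements X1 s1 \<times> displacements X2 s2)"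
    then obtain x1 x2 y1 y2 where x: "x1 \<in> X1" "x2 \<in> X2" "y1 \<in> X1" "y2 \<in> X2"
      and "f = prod_act X1 X2 (?s x1 \<otimes>\<^bsub>BijGroup X1\<^esub> inv\<^bsub>BijGroup X1\<^esub> ?s y1,
                        ?t x2 \<otimes>\<^bsub>BijGroup X2\<^esub> inv\<^bsub>BijGroup X2\<^esub> ?t y2)"
      unfolding displacements_def by blast
    then have "f = ?u (x1, x2) \<otimes>\<^bsub>BijGroup (X1 \<times> X2)\<^esub> inv\<^bsub>BijGroup (X1 \<times> X2)\<^esub> ?u (y1, y2)"
      using gen by simp
    then show "f \<in> displacements (X1 \<times> X2) (quandle_prod s1 s2)"
      using x unfolding displacements_def by blast
  qed
qed

theorem Dis_quandle_prod:
  assumes "quandle X1 s1" "quandle X2 s2"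
  shows "Dis (X1 \<times> X2) (quandle_prod s1 s2) = prod_act X1 X2 ` (Dis X1 s1 \<times> Dis X2 s2)"
proof -
  interpret A: quandle X1 s1 by fact
  interpret B: quandle X2 s2 by fact
  interpret h: group_hom "BijGroup X1 \<times>\<times> BijGroup X2" "BijGroup (X1 \<times> X2)" "prod_act X1 X2"
    by (rule group_hom_prod_act)
  let ?D = "displacements X1 s1 \<times> displacements X2 s2"
  have "?D \<subseteq> carrier (BijGroup X1 \<times>\<times> BijGroup X2)"
    using A.displacements_in_BijGroup B.displacements_in_BijGroup by auto
  then have "generate (BijGroup (X1 \<times> X2)) (prod_act X1 X2 ` ?D)
      = prod_act X1 X2 ` generate (BijGroup X1 \<times>\<times> BijGroup X2) ?D"
    by (simp add: h.generate_img)
  also have "generate (BijGroup X1 \<times>\<times> BijGroup X2) ?D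
      = generate (BijGroup X1) (displacements X1 s1) \<times> generate (BijGroup X2) (displacements X2 s2)"
    by (intro generate_DirProd group_BijGroup A.displacements_in_BijGroup
        B.displacements_in_BijGroup A.one_in_displacements B.one_in_displacements)
  finally show ?thesis
    by (simp add: Dis_eq_generate displacements_quandle_prod[OF assms])
qed

section \<open>Multiplicativity of the Euler characteristic\<close>

lemma Fix_prod_act: "Fix (prod_act X Y (g, h)) (X \<times> Y) = Fix g X \<times> Fix h Y"
  by (auto simp: Fix_def prod_act_def)

lemma card_of_Times_eq_cprod: "|A \<times> B| = |A| *c |B|"
  by (simp add: cprod_def Field_card_of)

lemma qdle_euler_char_le: "g \<in> Dis X s \<Longrightarrow> qdle_euler_char X s \<le>o |Fix g X|"
  using is_card_Inf_qdle_euler_char[of X s] unfolding is_card_Inf_def by blast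

text \<open>Cardinals are well-ordered, so some \<open>|Fix g X|\<close> is least; being itself a lower bound, it lies
  below the infimum.\<close>

lemma qdle_euler_char_attained:
  obtains g where "g \<in> Dis X s" "|Fix g X| =o qdle_euler_char X s"
proof -
  let ?R = "{|Fix g X| | g. g \<in> Dis X s}"
  have "\<one>\<^bsub>BijGroup X\<^esub> \<in> Dis X s" unfolding Dis_def by (rule generate.one)
  then have "?R \<noteq> {}" by blast
  moreover have "\<forall>r\<in>?R. Card_order r" by (auto simp: card_of_Card_order)
  ultimately obtain r where "r \<in> ?R" and min: "\<forall>r'\<in>?R. r \<le>o r'"
    using exists_minim_Card_order[of ?R] by blast
  then obtain g where g: "g \<in> Dis X s" "r = |Fix g X|" by blast
  have "|Fix g X| \<le>o qdle_euler_char X s"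
    using is_card_Inf_qdle_euler_char[of X s] min card_of_Card_order[of "Fix g X"]
    unfolding is_card_Inf_def g(2) by blast
  then show thesis
    using that g(1) qdle_euler_char_le ordIso_iff_ordLeq by blast
qed

theorem theorem1p8:
  fixes X1 :: "'a set" and s1 :: "'a \<Rightarrow> 'a \<Rightarrow> 'a"
    and X2 :: "'b set" and s2 :: "'b \<Rightarrow> 'b \<Rightarrow> 'b"
  assumes "quandle X1 s1" and "quandle X2 s2"
  shows "qdle_euler_char (X1 \<times> X2) (quandle_prod s1 s2) =o
         qdle_euler_char X1 s1 *c qdle_euler_char X2 s2"
proof -
  let ?X = "X1 \<times> X2" and ?s = "quandle_prod s1 s2"
  let ?c1 = "qdle_euler_char X1 s1" and ?c2 = "qdle_euler_char X2 s2"
  have "qdle_euler_char ?X ?s \<le>o ?c1 *c ?c2"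
  proof -
    obtain g h where g: "g \<in> Dis X1 s1" "|Fix g X1| =o ?c1"
      and h: "h \<in> Dis X2 s2" "|Fix h X2| =o ?c2"
      using qdle_euler_char_attained by metis
    have "prod_act X1 X2 (g, h) \<in> Dis ?X ?s"
      using g h by (simp add: Dis_quandle_prod[OF assms])
    then have "qdle_euler_char ?X ?s \<le>o |Fix g X1| *c |Fix h X2|"
      using qdle_euler_char_le by (metis Fix_prod_act card_of_Times_eq_cprod)
    then show ?thesis
      using cprod_cong[OF g(2) h(2)] ordLeq_ordIso_trans by blast
  qed
  moreover have "?c1 *c ?c2 \<le>o qdle_euler_char ?X ?s"
  proof -
    obtain f where f: "f \<in> Dis ?X ?s" "|Fix f ?X| =o qdle_euler_char ?X ?s"
      using qdle_euler_char_attained .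
    then obtain g h where gh: "g \<in> Dis X1 s1" "h \<in> Dis X2 s2" "f = prod_act X1 X2 (g, h)"
      by (auto simp: Dis_quandle_prod[OF assms])
    have "?c1 *c ?c2 \<le>o |Fix g X1| *c |Fix h X2|"
      using gh by (intro cprod_mono qdle_euler_char_le)
    then have "?c1 *c ?c2 \<le>o |Fix f ?X|"
      by (simp add: gh Fix_prod_act card_of_Times_eq_cprod)
    then show ?thesis using f(2) ordLeq_ordIso_trans by blast
  qed
  ultimately show ?thesis by (simp add: ordIso_iff_ordLeq)
qed

end
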